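(* Let $A,B\in\mathcal{M}_n$ be positive definite (invertible), $X\in\mathcal{M}_n$ and $0<r\leq 1$. Then for every unitarily invariant norm $|||\cdot|||$ on $\mathcal{M}_n$, $$|||A^rX-XB^r|||\leq r\,\max\left(\|A^{r-1}\|,\|B^{r-1}\|\right)\,|||AX-XB|||,$$ where $\|\cdot\|$ is the operator norm.
   Context: $\mathcal{M}_n$ is the algebra of $n\times n$ complex matrices. A unitarily invariant norm on $\mathcal{M}_n$ is a norm with $|||UXV|||=|||X|||$ for all unitary $U,V$ (equivalently, a symmetric gauge function of the singular values). *)

theory Defs
  imports "HOL-Analysis.Analysis"
begin

definition mat_adjoint :: "complex^'n^'m \<Rightarrow> complex^'m^'n" where
  "mat_adjoint A = (\<chi> i j. cnj (A $ j $ i))"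

definition unitary_mat :: "complex^'n^'n \<Rightarrow> bool" where
  "unitary_mat U \<longleftrightarrow> mat_adjoint U ** U = mat 1 \<and> U ** mat_adjoint U = mat 1"

definition hermitian_mat :: "complex^'n^'n \<Rightarrow> bool" where
  "hermitian_mat A \<longleftrightarrow> mat_adjoint A = A"

text \<open>For Hermitian matrices the quadratic form is real-valued, so taking the real part
  below loses no information.\<close>

definition positive_definite :: "complex^'n^'n \<Rightarrow> bool" where
  "positive_definite A \<longleftrightarrow> hermitian_mat A \<and>
     (\<forall>x. x \<noteq> 0 \<longrightarrow> Re (\<Sum>i\<in>UNIV. cnj (x $ i) * (A *v x) $ i) > 0)"

definition real_diag :: "('n \<Rightarrow> real) \<Rightarrow> complex^'n^'n" where
  "real_diag d = (\<chi> i j. if i = j then complex_of_real (d i) else 0)"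

text \<open>Real powers of a positive definite matrix by the spectral functional calculus:
  if \<open>A = U diag(d) U*\<close> with \<open>U\<close> unitary and all \<open>d i > 0\<close>, then \<open>A\<^sup>s = U diag(d\<^sup>s) U*\<close>.
  By the spectral theorem such a decomposition exists when \<open>A\<close> is positive definite; the
  result does not depend on its choice, see \<open>mat_powr_eq\<close> below. For other \<open>A\<close> the value
  is unspecified.\<close>

definition mat_powr :: "complex^'n^'n \<Rightarrow> real \<Rightarrow> complex^'n^'n" where
  "mat_powr A s = (THE P. \<exists>U d. unitary_mat U \<and> (\<forall>i. d i > 0) \<and>
     A = U ** real_diag d ** mat_adjoint U \<and>
     P = U ** real_diag (\<lambda>i. d i powr s) ** mat_adjoint U)"

text \<open>The operator norm induced by the Euclidean norm on \<open>\<complex>\<^sup>n\<close>.\<close>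

definition op_norm :: "complex^'n^'n \<Rightarrow> real" where
  "op_norm A = onorm ((*v) A)"

definition matrix_norm :: "(complex^'n^'n \<Rightarrow> real) \<Rightarrow> bool" where
  "matrix_norm N \<longleftrightarrow>
     (\<forall>X. N X \<ge> 0) \<and>
     (\<forall>X. N X = 0 \<longleftrightarrow> X = 0) \<and>
     (\<forall>c X. N (\<chi> i j. c * X $ i $ j) = cmod c * N X) \<and>
     (\<forall>X Y. N (X + Y) \<le> N X + N Y)"

definition unitarily_invariant_norm :: "(complex^'n^'n \<Rightarrow> real) \<Rightarrow> bool" where
  "unitarily_invariant_norm N \<longleftrightarrow> matrix_norm N \<and>
     (\<forall>U V X. unitary_mat U \<longrightarrow> unitary_mat V \<longrightarrow> N (U ** X ** V) = N X)"

lemma real_diag_mult_left: "(real_diag d ** M) $ i $ j = complex_of_real (d i) * M $ i $ j"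
  by (simp add: real_diag_def matrix_matrix_mult_def if_distrib[of "\<lambda>x. x * _"] cong: if_cong)

lemma real_diag_mult_right: "(M ** real_diag d) $ i $ j = M $ i $ j * complex_of_real (d j)"
  by (simp add: real_diag_def matrix_matrix_mult_def if_distrib[of "\<lambda>x. _ * x"] cong: if_cong)

lemma spectral_calculus_unique:
  fixes U V :: "complex^'n^'n" and f :: "real \<Rightarrow> real"
  assumes U: "unitary_mat U" and V: "unitary_mat V"
    and eq: "U ** real_diag d ** mat_adjoint U = V ** real_diag e ** mat_adjoint V"
  shows "U ** real_diag (\<lambda>i. f (d i)) ** mat_adjoint U
       = V ** real_diag (\<lambda>i. f (e i)) ** mat_adjoint V"
proof -
  define W where "W = mat_adjoint V ** U"
  have UU: "mat_adjoint U ** U = mat 1" "U ** mat_adjoint U = mat 1"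
    and VV: "mat_adjoint V ** V = mat 1" "V ** mat_adjoint V = mat 1"
    using U V by (auto simp: unitary_mat_def)
  have "W ** real_diag d = mat_adjoint V ** (U ** real_diag d ** mat_adjoint U) ** U"
    by (simp add: W_def UU flip: matrix_mul_assoc)
  also have "\<dots> = (mat_adjoint V ** V) ** real_diag e ** W"
    by (simp add: eq W_def matrix_mul_assoc)
  finally have "W ** real_diag d = real_diag e ** W"
    by (simp add: VV)
  then have comm: "W $ i $ j * complex_of_real (d j) = complex_of_real (e i) * W $ i $ j" for i j
    by (metis real_diag_mult_left real_diag_mult_right)
  have "W $ i $ j = 0 \<or> d j = e i" for i j
    using comm[of i j] by (auto simp: mult.commute)
  then have fcomm: "W ** real_diag (\<lambda>i. f (d i)) = real_diag (\<lambda>i. f (e i)) ** W"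
    by (simp only: vec_eq_iff real_diag_mult_left real_diag_mult_right) (metis mult.commute mult_zero_left)
  have "U ** real_diag (\<lambda>i. f (d i)) ** mat_adjoint U
      = V ** (W ** real_diag (\<lambda>i. f (d i))) ** mat_adjoint U"
    by (simp add: W_def matrix_mul_assoc VV)
  also have "\<dots> = V ** real_diag (\<lambda>i. f (e i)) ** mat_adjoint V ** (U ** mat_adjoint U)"
    by (simp add: fcomm) (simp add: W_def matrix_mul_assoc)
  finally show ?thesis
    by (simp add: UU)
qed

lemma mat_powr_eq:
  assumes "unitary_mat U" and "\<And>i. d i > 0"
  shows "mat_powr (U ** real_diag d ** mat_adjoint U) s
       = U ** real_diag (\<lambda>i. d i powr s) ** mat_adjoint U"
  unfolding mat_powr_def
proof (rule the_equality)
  show "\<exists>U' d'. unitary_mat U' \<and> (\<forall>i. d' i > 0) \<and>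
      U ** real_diag d ** mat_adjoint U = U' ** real_diag d' ** mat_adjoint U' \<and>
      U ** real_diag (\<lambda>i. d i powr s) ** mat_adjoint U
        = U' ** real_diag (\<lambda>i. d' i powr s) ** mat_adjoint U'"
    using assms by blast
next
  fix P
  assume "\<exists>U' d'. unitary_mat U' \<and> (\<forall>i. d' i > 0) \<and>
      U ** real_diag d ** mat_adjoint U = U' ** real_diag d' ** mat_adjoint U' \<and>
      P = U' ** real_diag (\<lambda>i. d' i powr s) ** mat_adjoint U'"
  then show "P = U ** real_diag (\<lambda>i. d i powr s) ** mat_adjoint U"
    using spectral_calculus_unique[OF assms(1), where f = "\<lambda>x. x powr s"] by metis
qed

end

theory Submission
  imports Defs
begin

text \<open>
  After diagonalising \<open>A = U diag(a) U*\<close> and \<open>B = V diag(b) V*\<close>, unitary invariance reduces the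
  claim to diagonal matrices, with \<open>X\<close> replaced by \<open>Y = U* X V\<close>. Let \<open>m\<close> and \<open>c\<close> be the smallest
  and the largest of all the \<open>a i\<close> and \<open>b j\<close>. Put \<open>z = 1 - a / c\<close> and \<open>w = 1 - b / c\<close>, with values in
  \<open>[0, t]\<close> where \<open>t = 1 - m / c < 1\<close>. For \<open>0 \<le> r \<le> 1\<close> the binomial series
  \<open>(1 - x)\<^sup>r = 1 - (\<Sum>n. p n * x\<^bsup>n+1\<^esup>)\<close> has nonnegative coefficients \<open>p n\<close>.

  The estimate is easy for each power: telescoping \<open>D\<^sub>z\<^bsup>n+1\<^esup> Y - Y D\<^sub>w\<^bsup>n+1\<^esup>\<close> into \<open>n + 1\<close> products
  \<open>D\<^sub>z\<^bsup>k\<^esup> (D\<^sub>z Y - Y D\<^sub>w) D\<^sub>w\<^bsup>n-k\<^esup>\<close> bounds its norm by \<open>(n + 1) t\<^bsup>n\<^esup>\<close> times the norm of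
  \<open>D\<^sub>z Y - Y D\<^sub>w\<close> (lemma \<open>norm_commutator_power_le\<close>). Because all \<open>p n\<close> are nonnegative, these
  bounds add up to the termwise derivative \<open>\<Sum>n. p n * (n + 1) * t\<^bsup>n\<^esup> = r (1 - t)\<^bsup>r-1\<^esup>\<close>
  (lemma \<open>norm_commutator_one_minus_powr_le\<close>). Undoing the scaling by \<open>c\<close> gives the constant
  \<open>r m\<^bsup>r-1\<^esup>\<close>, and \<open>m\<^bsup>r-1\<^esup>\<close> is an eigenvalue of \<open>A\<^bsup>r-1\<^esup>\<close> or of \<open>B\<^bsup>r-1\<^esup>\<close>, hence at most the larger
  of their operator norms.

  The argument needs the spectral theorem for Hermitian matrices and two properties of a unitarily
  invariant norm: it is continuous, and multiplying by a real diagonal matrix with entries in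
  \<open>[-t, t]\<close> enlarges it at most by the factor \<open>t\<close> (lemma \<open>norm_real_diag_mult_le\<close>).
\<close>

section \<open>The spectral theorem for Hermitian matrices\<close>

text \<open>
  The maximiser of the Rayleigh quotient on the unit sphere of \<open>T\<close> is an eigenvector. Passing to an
  invariant subspace \<open>T\<close> lets the lemma be iterated on orthogonal complements of eigenvectors
  already found.
\<close>

lemma symmetric_operator_eigenvector:
  fixes f :: "'a::euclidean_space \<Rightarrow> 'a"
  assumes "linear f" and sym: "\<And>x y. f x \<bullet> y = x \<bullet> f y"
    and T: "subspace T" "\<And>x. x \<in> T \<Longrightarrow> f x \<in> T" and "x\<^sub>0 \<in> T" "x\<^sub>0 \<noteq> 0"
  obtains x \<mu> where "x \<in> T" "norm x = 1" "f x = \<mu> *\<^sub>R x"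
proof -
  let ?K = "T \<inter> sphere 0 1"
  have "compact ?K"
    using T(1) by (intro closed_Int_compact closed_subspace compact_sphere)
  moreover have "?K \<noteq> {}"
  proof -
    have "(1 / norm x\<^sub>0) *\<^sub>R x\<^sub>0 \<in> ?K"
      using assms by (simp add: subspace_scale)
    then show ?thesis by blast
  qed
  moreover have "continuous_on ?K (\<lambda>x. x \<bullet> f x)"
    using assms(1) by (intro continuous_intros linear_continuous_on) (simp add: linear_conv_bounded_linear)
  ultimately obtain x where x: "x \<in> ?K" and max: "\<And>y. y \<in> ?K \<Longrightarrow> y \<bullet> f y \<le> x \<bullet> f x"
    using continuous_attains_sup[of ?K "\<lambda>x. x \<bullet> f x"] by metis
  define \<mu> where "\<mu> = x \<bullet> f x"
  have bound: "z \<bullet> f z \<le> \<mu> * (z \<bullet> z)" if "z \<in> T" for z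
  proof (cases "z = 0")
    case False
    then have "(1 / norm z) *\<^sub>R z \<in> ?K"
      using that T by (simp add: subspace_scale)
    from max[OF this] False show ?thesis
      by (simp add: \<mu>_def linear_scale[OF assms(1)] dot_square_norm field_simps power2_eq_square)
  qed (simp add: linear_0[OF assms(1)])
  define y where "y = f x - \<mu> *\<^sub>R x"
  have "y \<in> T"
    using x T by (simp add: y_def subspace_diff subspace_scale)
  define C where "C = \<mu> * (y \<bullet> y) - y \<bullet> f y"
  \<comment> \<open>Moving from \<open>x\<close> in the direction \<open>y\<close> changes \<open>z \<bullet> f z - \<mu> * (z \<bullet> z)\<close>, which is at most \<open>0\<close>
    and vanishes at \<open>x\<close>, by \<open>2 t |y|\<^sup>2\<close> to first order in \<open>t\<close>. This forces \<open>y = 0\<close>.\<close>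
  have first_order: "2 * t * (y \<bullet> y) \<le> t\<^sup>2 * C" for t
  proof -
    have "x + t *\<^sub>R y \<in> T"
      using x T \<open>y \<in> T\<close> by (simp add: subspace_add subspace_scale)
    from bound[OF this]
    have *: "x \<bullet> f x + 2 * t * (y \<bullet> f x) + t\<^sup>2 * (y \<bullet> f y)
        \<le> \<mu> * (x \<bullet> x + 2 * t * (y \<bullet> x) + t\<^sup>2 * (y \<bullet> y))"
      using sym[of x y]
      by (simp add: linear_add[OF assms(1)] linear_scale[OF assms(1)] inner_add_left inner_add_right
          inner_commute power2_eq_square algebra_simps)
    have "x \<bullet> x = 1"
      using x by (simp add: dot_square_norm)
    moreover have "y \<bullet> y = y \<bullet> f x - \<mu> * (y \<bullet> x)"
      by (subst (2) y_def) (simp add: inner_diff_right)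
    then have "2 * t * (y \<bullet> y) = 2 * t * (y \<bullet> f x - \<mu> * (y \<bullet> x))"
      by (simp only:)
    ultimately show ?thesis
      using * by (simp add: C_def \<mu>_def[symmetric] algebra_simps)
  qed
  have "y \<bullet> y \<le> 0"
  proof (rule ccontr)
    assume "\<not> y \<bullet> y \<le> 0"
    then have pos: "y \<bullet> y > 0" by (simp only: not_le)
    define t where "t = (y \<bullet> y) / (\<bar>C\<bar> + 1)"
    have "t > 0" using pos by (simp add: t_def)
    have "t * C \<le> t * (\<bar>C\<bar> + 1)"
      using \<open>t > 0\<close> by (intro mult_left_mono) auto
    also have "\<dots> = y \<bullet> y" by (simp add: t_def)
    finally have "t * (t * C) \<le> t * (y \<bullet> y)"
      using \<open>t > 0\<close> by (intro mult_left_mono) auto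
    with first_order[of t] have "t * (y \<bullet> y) \<le> 0"
      by (simp add: power2_eq_square mult.assoc)
    moreover have "t * (y \<bullet> y) > 0"
      using \<open>t > 0\<close> pos by (rule mult_pos_pos)
    ultimately show False by linarith
  qed
  then have "y = 0" by (metis inner_gt_zero_iff not_le)
  then have "f x = \<mu> *\<^sub>R x" by (simp add: y_def)
  with x show ?thesis using that by auto
qed

definition cinner :: "complex^'n \<Rightarrow> complex^'n \<Rightarrow> complex" where
  "cinner x y = (\<Sum>i\<in>UNIV. cnj (x $ i) * y $ i)"

text \<open>
  The real inner product of the Euclidean space \<open>\<complex>\<^sup>n\<close> is the real part of the Hermitian one, so results
  on real inner product spaces apply to Hermitian matrices.
\<close>

lemma Re_cinner: "Re (cinner x y) = x \<bullet> y"
  by (simp add: cinner_def inner_vec_def inner_complex_def)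

lemma cinner_commute: "cnj (cinner x y) = cinner y x"
  by (simp add: cinner_def mult.commute)

lemma cinner_self: "cinner x x = complex_of_real ((norm x)\<^sup>2)"
proof (rule complex_eqI)
  show "Re (cinner x x) = Re (complex_of_real ((norm x)\<^sup>2))"
    by (simp only: Re_cinner dot_square_norm) simp
  have "cnj (cinner x x) = cinner x x" by (rule cinner_commute)
  then show "Im (cinner x x) = Im (complex_of_real ((norm x)\<^sup>2))"
    by (simp add: complex_eq_iff)
qed

lemma cinner_scaleR_right: "cinner x (c *\<^sub>R y) = of_real c * cinner x y"
  unfolding cinner_def vector_scaleR_component
  by (simp add: scaleR_conv_of_real[where 'a=complex] sum_distrib_left algebra_simps)

lemma cinner_scaleR_left: "cinner (c *\<^sub>R x) y = of_real c * cinner x y"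
  by (metis cinner_commute cinner_scaleR_right complex_cnj_complex_of_real complex_cnj_mult)

lemma cinner_adjoint: "cinner (A *v x) y = cinner x (mat_adjoint A *v y)"
  unfolding cinner_def matrix_vector_mult_def mat_adjoint_def
  by (simp add: sum_distrib_left sum_distrib_right, subst sum.swap) (simp add: algebra_simps)

text \<open>
  The eigenvectors are found one at a time: the complex orthogonal complement of the previous ones is
  invariant under \<open>A\<close>, and it contains the next. Indexing them by a subset of the index type of
  the matrix makes them the columns of a matrix in the end, without any dimension count.
\<close>

lemma hermitian_orthonormal_eigenvectors:
  fixes A :: "complex^'n^'n"
  assumes herm: "hermitian_mat A" and "finite I"
  shows "\<exists>(u :: 'n \<Rightarrow> complex^'n) d. \<forall>i\<in>I. A *v u i = d i *\<^sub>R u i \<and>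
           (\<forall>j\<in>I. cinner (u i) (u j) = (if i = j then 1 else 0))"
  using \<open>finite I\<close>
proof (induction I rule: finite_induct)
  case empty
  then show ?case by simp
next
  case (insert k I)
  then obtain u d where eig: "\<And>i. i \<in> I \<Longrightarrow> A *v u i = d i *\<^sub>R u i"
    and orth: "\<And>i j. i \<in> I \<Longrightarrow> j \<in> I \<Longrightarrow> cinner (u i) (u j) = (if i = j then 1 else 0)"
    by metis
  \<comment> \<open>Row \<open>k\<close> of \<open>M\<close> vanishes, so \<open>M\<close> is singular; its kernel is the orthogonal complement of the \<open>u i\<close>.\<close>
  define M :: "complex^'n^'n" where "M = (\<chi> i j. if i \<in> I then cnj (u i $ j) else 0)"
  have M: "(M *v x) $ i = (if i \<in> I then cinner (u i) x else 0)" for x i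
    by (simp add: M_def matrix_vector_mult_def cinner_def)
  define T where "T = {x. M *v x = 0}"
  have T: "x \<in> T \<longleftrightarrow> (\<forall>i\<in>I. cinner (u i) x = 0)" for x
    by (auto simp: T_def vec_eq_iff M)
  have "row k M = 0"
    using insert.hyps by (simp add: row_def M_def vec_eq_iff)
  then have "det M = 0" by (rule det_zero_row)
  then have "\<not> invertible M" by (simp add: invertible_det_nz)
  then obtain x\<^sub>0 where "x\<^sub>0 \<in> T" "x\<^sub>0 \<noteq> 0"
    unfolding invertible_left_inverse matrix_left_invertible_ker T_def by auto
  have adj: "mat_adjoint A = A"
    using herm by (simp add: hermitian_mat_def)
  have sym: "(A *v x) \<bullet> y = x \<bullet> (A *v y)" for x y
    by (metis Re_cinner adj cinner_adjoint)
  have lin: "linear ((*v) N)" for N :: "complex^'n^'n"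
    by (simp add: bounded_linear.linear)
  have "subspace T"
    unfolding T_def by (rule linear_subspace_kernel[OF lin])
  moreover have "A *v x \<in> T" if "x \<in> T" for x
  proof -
    have "cinner (u i) (A *v x) = of_real (d i) * cinner (u i) x" if "i \<in> I" for i
      by (metis adj cinner_adjoint cinner_scaleR_left eig that)
    with that show ?thesis by (simp add: T)
  qed
  ultimately obtain x \<mu> where x: "x \<in> T" "norm x = 1" "A *v x = \<mu> *\<^sub>R x"
    using symmetric_operator_eigenvector[OF lin sym _ _ \<open>x\<^sub>0 \<in> T\<close> \<open>x\<^sub>0 \<noteq> 0\<close>] by metis
  have "cinner x (u i) = 0" if "i \<in> I" for i
    by (metis T cinner_commute complex_cnj_zero that x(1))
  then show ?case
    using x eig orth insert.hyps cinner_self[of x]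
    by (intro exI[of _ "u(k := x)"] exI[of _ "d(k := \<mu>)"]) (auto simp: T)
qed

lemma column_unitary_nonzero:
  assumes "unitary_mat U"
  shows "column j U \<noteq> 0"
proof
  assume "column j U = 0"
  then have "(mat_adjoint U ** U) $ j $ j = 0"
    by (simp add: matrix_matrix_mult_def column_def vec_eq_iff)
  then show False
    using assms by (simp add: unitary_mat_def mat_def)
qed

lemma mult_column: "A *v column j U = column j (A ** U)"
  by (simp add: vec_eq_iff matrix_matrix_mult_def matrix_vector_mult_def column_def)

lemma diagonalized_eigenvector:
  assumes "unitary_mat U"
  shows "(U ** real_diag d ** mat_adjoint U) *v column j U = d j *\<^sub>R column j U"
proof -
  have "U ** real_diag d ** mat_adjoint U ** U = U ** real_diag d"
    using assms by (simp add: unitary_mat_def flip: matrix_mul_assoc)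
  then have "(U ** real_diag d ** mat_adjoint U) *v column j U = column j (U ** real_diag d)"
    by (simp only: mult_column)
  then show ?thesis
    by (simp add: vec_eq_iff column_def real_diag_mult_right scaleR_conv_of_real[where 'a=complex])
qed

theorem hermitian_unitarily_diagonalizable:
  fixes A :: "complex^'n^'n"
  assumes "hermitian_mat A"
  obtains U d where "unitary_mat U" "A = U ** real_diag d ** mat_adjoint U"
proof -
  obtain u :: "'n \<Rightarrow> complex^'n" and d where eig: "\<And>i. A *v u i = d i *\<^sub>R u i"
    and orth: "\<And>i j. cinner (u i) (u j) = (if i = j then 1 else 0)"
    using hermitian_orthonormal_eigenvectors[OF assms finite] by (metis UNIV_I)
  define U where "U = (\<chi> i j. u j $ i)"
  have "mat_adjoint U ** U = mat 1"
    using orth by (simp add: mat_adjoint_def U_def matrix_matrix_mult_def mat_def cinner_def vec_eq_iff)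
  then have U: "unitary_mat U"
    by (simp add: unitary_mat_def matrix_left_right_inverse[of U])
  have "A ** U = U ** real_diag d"
  proof -
    have "(A ** U) $ i $ j = (A *v u j) $ i" for i j
      by (simp add: matrix_matrix_mult_def matrix_vector_mult_def U_def)
    then show ?thesis
      unfolding vec_eq_iff real_diag_mult_right
      by (simp add: eig U_def scaleR_conv_of_real[where 'a=complex])
  qed
  then have "A = U ** real_diag d ** mat_adjoint U"
    using U by (metis matrix_mul_assoc matrix_mul_rid unitary_mat_def)
  with U that show ?thesis by blast
qed

lemma positive_definite_diagonalization:
  assumes "positive_definite A"
  obtains U d where "unitary_mat U" "\<And>j. d j > 0" "A = U ** real_diag d ** mat_adjoint U"
proof -
  obtain U d where U: "unitary_mat U" and A: "A = U ** real_diag d ** mat_adjoint U"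
    using hermitian_unitarily_diagonalizable assms unfolding positive_definite_def by metis
  have "d j > 0" for j
  proof -
    let ?x = "column j U"
    have nz: "?x \<noteq> 0" by (rule column_unitary_nonzero[OF U])
    then have "Re (cinner ?x (A *v ?x)) > 0"
      using assms by (simp add: positive_definite_def cinner_def)
    then have "d j * (?x \<bullet> ?x) > 0"
      by (simp only: A diagonalized_eigenvector[OF U] Re_cinner inner_scaleR_right)
    then show ?thesis
      using nz by (meson inner_gt_zero_iff zero_less_mult_pos2)
  qed
  with U A that show ?thesis by blast
qed

text \<open>Every eigenvalue is attained on a column of \<open>U\<close>. Applied to \<open>A\<^bsup>r-1\<^esup>\<close> this turns a bound by
  \<open>m\<^bsup>r-1\<^esup>\<close>, with \<open>m\<close> an eigenvalue of \<open>A\<close>, into a bound by an operator norm.\<close>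

lemma eigenvalue_le_op_norm:
  assumes "unitary_mat U"
  shows "d j \<le> op_norm (U ** real_diag d ** mat_adjoint U)"
proof -
  let ?P = "U ** real_diag d ** mat_adjoint U" and ?x = "column j U"
  have "\<bar>d j\<bar> * norm ?x = norm (?P *v ?x)"
    by (simp add: diagonalized_eigenvector[OF assms])
  also have "\<dots> \<le> op_norm ?P * norm ?x"
    unfolding op_norm_def by (rule onorm) simp
  finally have "\<bar>d j\<bar> \<le> op_norm ?P"
    using column_unitary_nonzero[OF assms, of j] by simp
  then show ?thesis by linarith
qed

section \<open>Unitarily invariant norms\<close>

lemma matrix_norm_zero:
  assumes "matrix_norm N"
  shows "N 0 = 0"
  using assms unfolding matrix_norm_def by blast

lemma matrix_norm_scaleR:
  assumes "matrix_norm N"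
  shows "N (c *\<^sub>R X) = \<bar>c\<bar> * N X"
proof -
  have "c *\<^sub>R X = (\<chi> i j. of_real c * X $ i $ j)"
    by (simp add: vec_eq_iff scaleR_conv_of_real[where 'a=complex])
  then show ?thesis
    using assms by (simp add: matrix_norm_def)
qed

lemma matrix_norm_sum_le:
  assumes "matrix_norm N"
  shows "N (\<Sum>i\<in>S. f i) \<le> (\<Sum>i\<in>S. N (f i))"
proof (induction S rule: infinite_finite_induct)
  case (insert x S)
  have "N (f x + (\<Sum>i\<in>S. f i)) \<le> N (f x) + N (\<Sum>i\<in>S. f i)"
    using assms by (simp add: matrix_norm_def)
  with insert show ?case by simp
qed (simp_all add: matrix_norm_zero[OF assms])

text \<open>A norm is a convex function, and finite convex functions on a finite-dimensional space are
  continuous.\<close>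

lemma matrix_norm_tendsto:
  assumes N: "matrix_norm N" and "S \<longlonglongrightarrow> L"
  shows "(\<lambda>k. N (S k)) \<longlonglongrightarrow> N L"
proof -
  have "convex_on UNIV N"
  proof (rule convex_onI)
    fix t :: real and X Y
    assume "t > 0" "t < 1"
    have "N ((1 - t) *\<^sub>R X + t *\<^sub>R Y) \<le> N ((1 - t) *\<^sub>R X) + N (t *\<^sub>R Y)"
      using N by (simp add: matrix_norm_def)
    then show "N ((1 - t) *\<^sub>R X + t *\<^sub>R Y) \<le> (1 - t) * N X + t * N Y"
      using \<open>t > 0\<close> \<open>t < 1\<close> by (simp add: matrix_norm_scaleR[OF N])
  qed simp
  then have "continuous_on UNIV N"
    by (intro convex_on_continuous) auto
  then show ?thesis
    using assms(2) by (auto simp: continuous_on_eq_continuous_at intro: isCont_tendsto_compose)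
qed

lemma scaleR_matrix_mult_left: "(c *\<^sub>R A) ** B = c *\<^sub>R (A ** B)"
  for A :: "complex^'n^'m" and B :: "complex^'p^'n"
  by (simp add: vec_eq_iff matrix_matrix_mult_def scaleR_sum_right)

lemma scaleR_matrix_mult_right: "A ** (c *\<^sub>R B) = c *\<^sub>R (A ** B)"
  for A :: "complex^'n^'m" and B :: "complex^'p^'n"
  by (simp add: vec_eq_iff matrix_matrix_mult_def scaleR_sum_right)

lemma unitary_mat_adjoint: "unitary_mat U \<Longrightarrow> unitary_mat (mat_adjoint U)"
  by (auto simp: unitary_mat_def mat_adjoint_def)

lemma unitary_mat_1: "unitary_mat (mat 1)"
proof -
  have "mat_adjoint (mat 1) = (mat 1 :: complex^'n^'n)"
    by (simp add: mat_adjoint_def mat_def vec_eq_iff)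
  then show ?thesis by (simp add: unitary_mat_def)
qed

text \<open>
  A real number in \<open>[-t, t]\<close> is \<open>t cos \<theta>\<close>, which is \<open>t / 2\<close> times the sum of the conjugate
  unimodular numbers \<open>exp(i \<theta>)\<close> and \<open>exp(- i \<theta>)\<close>. Applied to every diagonal entry, this reduces
  multiplication by a diagonal matrix to multiplication by unitary ones.
\<close>

lemma real_diag_average_of_unitaries:
  fixes d :: "'n::finite \<Rightarrow> real"
  assumes "\<And>i. \<bar>d i\<bar> \<le> t"
  obtains U :: "complex^'n^'n" where "unitary_mat U" "real_diag d = (t / 2) *\<^sub>R (U + mat_adjoint U)"
proof -
  define \<theta> where "\<theta> i = arccos (d i / t)" for i
  define U :: "complex^'n^'n" where "U = (\<chi> i j. if i = j then cis (\<theta> i) else 0)"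
  have "(U ** M) $ i $ j = cis (\<theta> i) * M $ i $ j" for M :: "complex^'n^'n" and i j
    by (simp add: U_def matrix_matrix_mult_def if_distrib[of "\<lambda>x. x * _"] cong: if_cong)
  then have "U ** mat_adjoint U = mat 1"
    by (simp add: vec_eq_iff mat_adjoint_def mat_def U_def cis_mult cis_cnj)
  then have "unitary_mat U"
    by (simp add: unitary_mat_def matrix_left_right_inverse[of U])
  moreover have "d i = t * cos (\<theta> i)" for i
    using assms[of i] by (cases "t = 0") (auto simp: \<theta>_def abs_le_iff field_simps cos_arccos)
  then have "real_diag d = (t / 2) *\<^sub>R (U + mat_adjoint U)"
    by (simp add: vec_eq_iff real_diag_def U_def mat_adjoint_def complex_eq_iff)
  ultimately show ?thesis using that by blast
qed

lemma norm_real_diag_mult_le: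
  fixes N :: "complex^'n^'n \<Rightarrow> real"
  assumes N: "unitarily_invariant_norm N" and d: "\<And>i. \<bar>d i\<bar> \<le> t"
  shows "N (real_diag d ** X) \<le> t * N X" and "N (X ** real_diag d) \<le> t * N X"
proof -
  obtain U where U: "unitary_mat U" and eq: "real_diag d = (t / 2) *\<^sub>R (U + mat_adjoint U)"
    using real_diag_average_of_unitaries[of d t, OF d] by metis
  have mn: "matrix_norm N" and inv: "\<And>V W X. unitary_mat V \<Longrightarrow> unitary_mat W \<Longrightarrow> N (V ** X ** W) = N X"
    using N by (auto simp: unitarily_invariant_norm_def)
  have tri: "N (Y + Z) \<le> N Y + N Z" for Y Z
    using mn by (simp add: matrix_norm_def)
  have "t \<ge> 0" using d[of undefined] by linarith
  have left: "N (V ** X) = N X" and right: "N (X ** V) = N X" if "unitary_mat V" for V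
    using inv[OF that unitary_mat_1, of X] inv[OF unitary_mat_1 that, of X] by simp_all
  have distrib: "(V + W) ** X = V ** X + W ** X" for V W
    by (simp add: vec_eq_iff matrix_matrix_mult_def sum.distrib algebra_simps)
  have "N (real_diag d ** X) = t / 2 * N (U ** X + mat_adjoint U ** X)"
    using \<open>t \<ge> 0\<close> by (simp add: eq scaleR_matrix_mult_left matrix_norm_scaleR[OF mn] distrib)
  also have "\<dots> \<le> t / 2 * (N X + N X)"
    using \<open>t \<ge> 0\<close> tri[of "U ** X" "mat_adjoint U ** X"] U
    by (intro mult_left_mono) (simp_all add: left unitary_mat_adjoint)
  finally show "N (real_diag d ** X) \<le> t * N X" by simp
  have "N (X ** real_diag d) = t / 2 * N (X ** U + X ** mat_adjoint U)"
    using \<open>t \<ge> 0\<close> by (simp add: eq scaleR_matrix_mult_right matrix_norm_scaleR[OF mn] matrix_add_ldistrib)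
  also have "\<dots> \<le> t / 2 * (N X + N X)"
    using \<open>t \<ge> 0\<close> tri[of "X ** U" "X ** mat_adjoint U"] U
    by (intro mult_left_mono) (simp_all add: right unitary_mat_adjoint)
  finally show "N (X ** real_diag d) \<le> t * N X" by simp
qed

section \<open>Generalised commutators of powers\<close>

text \<open>
  The noncommutative form of \<open>|z\<^bsup>n+1\<^esup> - w\<^bsup>n+1\<^esup>| \<le> (n + 1) t\<^bsup>n\<^esup> |z - w|\<close>. The induction peels one
  factor off, following \<open>z\<^bsup>n+2\<^esup> - w\<^bsup>n+2\<^esup> = z (z\<^bsup>n+1\<^esup> - w\<^bsup>n+1\<^esup>) + (z - w) w\<^bsup>n+1\<^esup>\<close>, where \<open>z\<close> acts from
  the left and \<open>w\<close> from the right.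
\<close>

lemma norm_commutator_power_le:
  fixes N :: "complex^'n^'n \<Rightarrow> real" and z w :: "'n \<Rightarrow> real" and t :: real
  assumes N: "unitarily_invariant_norm N" and z: "\<And>i. \<bar>z i\<bar> \<le> t" and w: "\<And>i. \<bar>w i\<bar> \<le> t"
  shows "N (real_diag (\<lambda>i. z i ^ Suc n) ** Y - Y ** real_diag (\<lambda>i. w i ^ Suc n))
       \<le> Suc n * t ^ n * N (real_diag z ** Y - Y ** real_diag w)"
proof (induction n)
  case 0
  then show ?case by simp
next
  case (Suc n)
  let ?C = "\<lambda>k. real_diag (\<lambda>i. z i ^ k) ** Y - Y ** real_diag (\<lambda>i. w i ^ k)"
  let ?E = "real_diag z ** Y - Y ** real_diag w"
  have "t \<ge> 0" using z[of undefined] by linarith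
  have "?C (Suc (Suc n)) = real_diag z ** ?C (Suc n) + ?E ** real_diag (\<lambda>i. w i ^ Suc n)"
    by (simp add: vec_eq_iff real_diag_mult_left real_diag_mult_right algebra_simps)
  then have "N (?C (Suc (Suc n))) \<le> N (real_diag z ** ?C (Suc n)) + N (?E ** real_diag (\<lambda>i. w i ^ Suc n))"
    using N by (simp add: unitarily_invariant_norm_def matrix_norm_def)
  also have "\<dots> \<le> t * N (?C (Suc n)) + t ^ Suc n * N ?E"
    using w by (intro add_mono norm_real_diag_mult_le[OF N] z) (simp add: power_abs power_mono del: power_Suc)
  also have "\<dots> \<le> t * (Suc n * t ^ n * N ?E) + t ^ Suc n * N ?E"
    using \<open>t \<ge> 0\<close> Suc.IH by (intro add_right_mono mult_left_mono)
  also have "\<dots> = Suc (Suc n) * t ^ Suc n * N ?E"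
    by (simp add: algebra_simps)
  finally show ?case .
qed

text \<open>
  The absorption identity for binomial coefficients equates this with \<open>(-1)\<^bsup>n\<^esup> (r gchoose (n + 1))\<close>,
  the coefficient of \<open>x\<^bsup>n+1\<^esup>\<close> in \<open>1 - (1 - x)\<^sup>r\<close>. The present form shows the sign, since \<open>r - 1 \<le> 0\<close>,
  and makes the coefficients of the derivative visible.
\<close>

definition powr_coeff :: "real \<Rightarrow> nat \<Rightarrow> real" where
  "powr_coeff r n = r / Suc n * ((-1) ^ n * ((r - 1) gchoose n))"

lemma powr_coeff_nonneg:
  assumes "0 \<le> r" "r \<le> 1"
  shows "powr_coeff r n \<ge> 0"
proof -
  have "pochhammer (1 - r) n \<ge> 0"
    using assms by (induction n) (auto simp: pochhammer_Suc)
  then have "(-1) ^ n * ((r - 1) gchoose n) \<ge> 0"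
    by (simp add: gbinomial_pochhammer flip: mult.assoc power_mult_distrib)
  then show ?thesis
    using assms(1) unfolding powr_coeff_def by (simp only: mult_nonneg_nonneg divide_nonneg_nonneg of_nat_0_le_iff)
qed

lemma powr_series:
  fixes z r :: real
  assumes "0 \<le> z" "z < 1"
  shows "(\<lambda>n. powr_coeff r n * z ^ Suc n) sums (1 - (1 - z) powr r)"
proof -
  have "(\<lambda>n. (r gchoose n) * (- z) ^ n) sums (1 - z) powr r"
    using gen_binomial_real[of "- z" r] assms by simp
  then have "(\<lambda>n. (r gchoose Suc n) * (- z) ^ Suc n) sums ((1 - z) powr r - 1)"
    using sums_Suc_iff[of "\<lambda>n. (r gchoose n) * (- z) ^ n" "(1 - z) powr r - 1"] by simp
  then have "(\<lambda>n. - ((r gchoose Suc n) * (- z) ^ Suc n)) sums (1 - (1 - z) powr r)"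
    using sums_minus by fastforce
  moreover have "- ((r gchoose Suc n) * (- z) ^ Suc n) = powr_coeff r n * z ^ Suc n" for n
    using gbinomial_absorption'[of "Suc n" r]
    by (simp add: powr_coeff_def power_minus[of z n] del: of_nat_Suc)
  ultimately show ?thesis by (simp only:)
qed

lemma powr_derivative_series:
  fixes z r :: real
  assumes "0 \<le> z" "z < 1"
  shows "(\<lambda>n. powr_coeff r n * (Suc n * z ^ n)) sums (r * (1 - z) powr (r - 1))"
proof -
  have "(\<lambda>n. r * (((r - 1) gchoose n) * (- z) ^ n)) sums (r * (1 - z) powr (r - 1))"
    using gen_binomial_real[of "- z" "r - 1"] assms by (intro sums_mult) simp
  moreover have "r * (((r - 1) gchoose n) * (- z) ^ n) = powr_coeff r n * (Suc n * z ^ n)" for n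
  proof -
    have "powr_coeff r n * Suc n = r * ((-1) ^ n * ((r - 1) gchoose n))"
      by (simp add: powr_coeff_def del: of_nat_Suc)
    then have "powr_coeff r n * Suc n * z ^ n = r * ((-1) ^ n * ((r - 1) gchoose n)) * z ^ n"
      by (simp only:)
    then show ?thesis
      by (simp only: power_minus[of z n] mult_ac)
  qed
  ultimately show ?thesis by (simp only:)
qed

text \<open>
  Expanding \<open>1 - (1 - z)\<^sup>r\<close> and \<open>1 - (1 - w)\<^sup>r\<close> in powers writes the left-hand commutator, up to
  sign, as the limit of the partial sums \<open>S k\<close> below. The bounds for the single powers sum to at most
  the derivative of \<open>x \<mapsto> 1 - (1 - x)\<^sup>r\<close> at \<open>t\<close>, and the bound passes to the limit.
\<close>

lemma norm_commutator_one_minus_powr_le: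
  fixes Y :: "complex^'n^'n"
  assumes N: "unitarily_invariant_norm N" and r: "0 \<le> r" "r \<le> 1" and "t < 1"
    and z: "\<And>i. 0 \<le> z i" "\<And>i. z i \<le> t" and w: "\<And>i. 0 \<le> w i" "\<And>i. w i \<le> t"
  shows "N (real_diag (\<lambda>i. (1 - z i) powr r) ** Y - Y ** real_diag (\<lambda>i. (1 - w i) powr r))
       \<le> r * (1 - t) powr (r - 1) * N (real_diag z ** Y - Y ** real_diag w)"
proof -
  let ?C = "\<lambda>k. real_diag (\<lambda>i. z i ^ k) ** Y - Y ** real_diag (\<lambda>i. w i ^ k)"
  let ?E = "real_diag z ** Y - Y ** real_diag w"
  let ?L = "real_diag (\<lambda>i. (1 - z i) powr r) ** Y - Y ** real_diag (\<lambda>i. (1 - w i) powr r)"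
  have mn: "matrix_norm N" and "N ?E \<ge> 0"
    using N by (auto simp: unitarily_invariant_norm_def matrix_norm_def)
  have "t \<ge> 0" using z order_trans by blast
  define S where "S k = (\<Sum>n<k. powr_coeff r n *\<^sub>R ?C (Suc n))" for k
  have "S \<longlonglongrightarrow> - ?L"
  proof (intro vec_tendstoI)
    fix i j
    have "(\<lambda>n. powr_coeff r n * z i ^ Suc n - powr_coeff r n * w j ^ Suc n)
        sums ((1 - (1 - z i) powr r) - (1 - (1 - w j) powr r))"
      using z[of i] w[of j] \<open>t < 1\<close> by (intro sums_diff powr_series) auto
    then have "(\<lambda>k. of_real (\<Sum>n<k. powr_coeff r n * z i ^ Suc n - powr_coeff r n * w j ^ Suc n) * Y $ i $ j)
        \<longlonglongrightarrow> of_real ((1 - (1 - z i) powr r) - (1 - (1 - w j) powr r)) * Y $ i $ j"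
      unfolding sums_def by (intro tendsto_intros)
    moreover have "S k $ i $ j
        = of_real (\<Sum>n<k. powr_coeff r n * z i ^ Suc n - powr_coeff r n * w j ^ Suc n) * Y $ i $ j" for k
      by (simp add: S_def real_diag_mult_left real_diag_mult_right scaleR_conv_of_real[where 'a=complex]
          sum_distrib_left sum_distrib_right algebra_simps)
    moreover have "(- ?L) $ i $ j = of_real ((1 - (1 - z i) powr r) - (1 - (1 - w j) powr r)) * Y $ i $ j"
      by (simp add: real_diag_mult_left real_diag_mult_right algebra_simps)
    ultimately show "(\<lambda>k. S k $ i $ j) \<longlonglongrightarrow> (- ?L) $ i $ j"
      by simp
  qed
  then have "(\<lambda>k. N (S k)) \<longlonglongrightarrow> N (- ?L)"
    by (rule matrix_norm_tendsto[OF mn])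
  moreover have "N (S k) \<le> r * (1 - t) powr (r - 1) * N ?E" for k
  proof -
    have term_le: "N (powr_coeff r n *\<^sub>R ?C (Suc n)) \<le> powr_coeff r n * (Suc n * t ^ n * N ?E)" for n
    proof -
      have "N (?C (Suc n)) \<le> Suc n * t ^ n * N ?E"
        by (rule norm_commutator_power_le[OF N]) (use z w in auto)
      then show ?thesis
        using powr_coeff_nonneg[OF r, of n]
        by (simp only: matrix_norm_scaleR[OF mn] abs_of_nonneg mult_left_mono)
    qed
    have "N (S k) \<le> (\<Sum>n<k. N (powr_coeff r n *\<^sub>R ?C (Suc n)))"
      unfolding S_def by (rule matrix_norm_sum_le[OF mn])
    also have "\<dots> \<le> (\<Sum>n<k. powr_coeff r n * (Suc n * t ^ n * N ?E))"
      by (intro sum_mono term_le)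
    also have "\<dots> = (\<Sum>n<k. powr_coeff r n * (Suc n * t ^ n)) * N ?E"
      by (simp add: sum_distrib_right mult.assoc)
    also have "\<dots> \<le> r * (1 - t) powr (r - 1) * N ?E"
    proof (intro mult_right_mono)
      have sums: "(\<lambda>n. powr_coeff r n * (Suc n * t ^ n)) sums (r * (1 - t) powr (r - 1))"
        using \<open>t \<ge> 0\<close> \<open>t < 1\<close> by (rule powr_derivative_series)
      have "(\<Sum>n<k. powr_coeff r n * (Suc n * t ^ n)) \<le> (\<Sum>n. powr_coeff r n * (Suc n * t ^ n))"
        using \<open>t \<ge> 0\<close> powr_coeff_nonneg[OF r]
        by (intro sum_le_suminf sums_summable[OF sums]) auto
      then show "(\<Sum>n<k. powr_coeff r n * (Suc n * t ^ n)) \<le> r * (1 - t) powr (r - 1)"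
        by (simp only: sums_unique[OF sums, symmetric])
    qed fact
    finally show ?thesis .
  qed
  ultimately have "N (- ?L) \<le> r * (1 - t) powr (r - 1) * N ?E"
    by (intro LIMSEQ_le_const2) auto
  moreover have "N (- ?L) = N ?L"
    using matrix_norm_scaleR[OF mn, of "-1" ?L] by simp
  ultimately show ?thesis by simp
qed

text \<open>
  Dividing by the largest diagonal entry \<open>c\<close> brings all entries into \<open>(0, 1]\<close>, where the binomial series
  around \<open>1\<close> converges. The powers of \<open>c\<close> cancel, since both sides are homogeneous of degree \<open>r\<close>
  in \<open>(a, b, m)\<close>.
\<close>

lemma norm_commutator_powr_le:
  fixes Y :: "complex^'n^'n"
  assumes N: "unitarily_invariant_norm N" and r: "0 \<le> r" "r \<le> 1" and "0 < m"
    and a: "\<And>i. m \<le> a i" and b: "\<And>i. m \<le> b i"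
  shows "N (real_diag (\<lambda>i. a i powr r) ** Y - Y ** real_diag (\<lambda>i. b i powr r))
       \<le> r * m powr (r - 1) * N (real_diag a ** Y - Y ** real_diag b)"
proof -
  define c where "c = Max (range a \<union> range b)"
  have ac: "a i \<le> c" and bc: "b i \<le> c" for i
    by (simp_all add: c_def)
  have "m \<le> c" using a ac order_trans by blast
  with \<open>0 < m\<close> have "c > 0" by simp
  define z w t where "z i = 1 - a i / c" and "w i = 1 - b i / c" and "t = 1 - m / c" for i
  have mn: "matrix_norm N"
    using N by (simp add: unitarily_invariant_norm_def)
  let ?R = "real_diag (\<lambda>i. a i powr r) ** Y - Y ** real_diag (\<lambda>i. b i powr r)"
  let ?E = "real_diag a ** Y - Y ** real_diag b"
  have R: "real_diag (\<lambda>i. (1 - z i) powr r) ** Y - Y ** real_diag (\<lambda>i. (1 - w i) powr r)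
      = (1 / c powr r) *\<^sub>R ?R"
    using \<open>0 < m\<close> \<open>c > 0\<close> a b
    by (simp add: vec_eq_iff real_diag_mult_left real_diag_mult_right z_def w_def powr_divide
        order_trans[OF less_imp_le[OF \<open>0 < m\<close>]] scaleR_conv_of_real[where 'a=complex] field_simps)
  have E: "real_diag z ** Y - Y ** real_diag w = (- (1 / c)) *\<^sub>R ?E"
    using \<open>c > 0\<close>
    by (simp add: vec_eq_iff real_diag_mult_left real_diag_mult_right z_def w_def
        scaleR_conv_of_real[where 'a=complex] field_simps)
  have "N (real_diag (\<lambda>i. (1 - z i) powr r) ** Y - Y ** real_diag (\<lambda>i. (1 - w i) powr r))
      \<le> r * (1 - t) powr (r - 1) * N (real_diag z ** Y - Y ** real_diag w)"
    using ac bc a b \<open>c > 0\<close> \<open>m > 0\<close>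
    by (intro norm_commutator_one_minus_powr_le[OF N r])
      (simp_all add: z_def w_def t_def divide_right_mono)
  then have "N ?R / c powr r \<le> r * (m / c) powr (r - 1) * (N ?E / c)"
    unfolding R E matrix_norm_scaleR[OF mn] using \<open>c > 0\<close> by (simp add: t_def)
  also have "\<dots> = r * m powr (r - 1) * N ?E / c powr r"
    using \<open>c > 0\<close> \<open>m > 0\<close> by (simp add: powr_divide powr_diff mult_ac)
  finally show ?thesis
    using \<open>c > 0\<close> by (simp add: divide_le_cancel)
qed

section \<open>The inequality for positive definite matrices\<close>

text \<open>The commutator for \<open>X\<close> is \<open>U\<close> times the diagonal commutator for \<open>U* X V\<close> times \<open>V*\<close>, so their
  norms agree. The same \<open>U\<close> and \<open>V\<close> serve the matrices and their powers, so the lemma is applied on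
  both sides of the inequality with the same \<open>U* X V\<close>.\<close>

lemma norm_commutator_diagonalized:
  assumes N: "unitarily_invariant_norm N" and U: "unitary_mat U" and V: "unitary_mat V"
  shows "N (U ** real_diag f ** mat_adjoint U ** X - X ** (V ** real_diag g ** mat_adjoint V))
       = N (real_diag f ** (mat_adjoint U ** X ** V) - (mat_adjoint U ** X ** V) ** real_diag g)"
proof -
  let ?P = "U ** real_diag f ** mat_adjoint U" and ?Q = "V ** real_diag g ** mat_adjoint V"
  have diff: "mat_adjoint U ** (G - H) ** V = mat_adjoint U ** G ** V - mat_adjoint U ** H ** V" for G H
    by (simp add: vec_eq_iff matrix_matrix_mult_def sum_subtractf algebra_simps)
  have "mat_adjoint U ** (?P ** X) ** V = (mat_adjoint U ** U) ** real_diag f ** (mat_adjoint U ** X ** V)"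
    by (simp only: matrix_mul_assoc)
  moreover have "mat_adjoint U ** (X ** ?Q) ** V = (mat_adjoint U ** X ** V) ** real_diag g ** (mat_adjoint V ** V)"
    by (simp only: matrix_mul_assoc)
  ultimately have "mat_adjoint U ** (?P ** X - X ** ?Q) ** V
      = real_diag f ** (mat_adjoint U ** X ** V) - (mat_adjoint U ** X ** V) ** real_diag g"
    using U V by (simp add: diff unitary_mat_def)
  then show ?thesis
    using N unitary_mat_adjoint[OF U] V unfolding unitarily_invariant_norm_def by metis
qed

theorem theorem4p6:
  fixes A B X :: "complex^'n^'n" and r :: real and N :: "complex^'n^'n \<Rightarrow> real"
  assumes "positive_definite A" and "positive_definite B"
    and "0 < r" and "r \<le> 1"
    and "unitarily_invariant_norm N"
  shows "N (mat_powr A r ** X - X ** mat_powr B r)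
    \<le> r * max (op_norm (mat_powr A (r - 1))) (op_norm (mat_powr B (r - 1)))
        * N (A ** X - X ** B)"
proof -
  obtain U a where U: "unitary_mat U" and a: "\<And>i. a i > 0" and A: "A = U ** real_diag a ** mat_adjoint U"
    using positive_definite_diagonalization[OF assms(1)] by metis
  obtain V b where V: "unitary_mat V" and b: "\<And>i. b i > 0" and B: "B = V ** real_diag b ** mat_adjoint V"
    using positive_definite_diagonalization[OF assms(2)] by metis
  define m where "m = Min (range a \<union> range b)"
  have m: "m \<le> a i" "m \<le> b i" for i
    by (simp_all add: m_def)
  have "m \<in> range a \<union> range b"
    unfolding m_def by (rule Min_in) auto
  then have "m > 0"
    and "m powr (r - 1) \<le> max (op_norm (mat_powr A (r - 1))) (op_norm (mat_powr B (r - 1)))"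
    using a b eigenvalue_le_op_norm[OF U, of "\<lambda>i. a i powr (r - 1)"]
      eigenvalue_le_op_norm[OF V, of "\<lambda>i. b i powr (r - 1)"]
    by (auto simp: A B mat_powr_eq U V le_max_iff_disj)
  let ?Y = "mat_adjoint U ** X ** V"
  have "N (mat_powr A r ** X - X ** mat_powr B r)
      = N (real_diag (\<lambda>i. a i powr r) ** ?Y - ?Y ** real_diag (\<lambda>i. b i powr r))"
    by (simp only: A B mat_powr_eq[of _ a, OF U a] mat_powr_eq[of _ b, OF V b]
        norm_commutator_diagonalized[OF assms(5) U V])
  also have "\<dots> \<le> r * m powr (r - 1) * N (real_diag a ** ?Y - ?Y ** real_diag b)"
    using assms m \<open>m > 0\<close> by (intro norm_commutator_powr_le) auto
  also have "\<dots> = r * m powr (r - 1) * N (A ** X - X ** B)"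
    by (simp only: A B norm_commutator_diagonalized[OF assms(5) U V])
  also have "\<dots> \<le> r * max (op_norm (mat_powr A (r - 1))) (op_norm (mat_powr B (r - 1)))
        * N (A ** X - X ** B)"
    using assms(3,5) \<open>m powr (r - 1) \<le> _\<close>
    by (intro mult_right_mono mult_left_mono) (auto simp: unitarily_invariant_norm_def matrix_norm_def)
  finally show ?thesis .
qed

end
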